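(* Let $A$ be an associative triple trisystem of the second kind over $\phi$, with triple products $\{\,,\,,\,\}_1,\{\,,\,,\,\}_2,\{\,,\,,\,\}_3$. Then $A$ with the triple product $$[a,b,c]:=\{a,b,c\}_1-\{b,a,c\}_2-\{c,a,b\}_2+\{c,b,a\}_3\qquad(a,b,c\in A)$$ is a Leibniz triple system.
   Context: $\phi$ is a scalar ring (commutative, unital) with $\frac12\in\phi$. An associative triple trisystem of the second kind is a $\phi$-module $A$ with three trilinear maps $\{\,,\,,\,\}_i:A\times A\times A\to A$, $i\in\{1,2,3\}$, satisfying for all $a,b,c,d,e\in A$: (1) $\{\{a,b,c\}_1,d,e\}_1=\{a,\{d,c,b\}_1,e\}_1=\{a,b,\{c,d,e\}_1\}_1$; (2) $\{\{a,b,c\}_2,d,e\}_1=\{a,\{d,c,b\}_3,e\}_2=\{a,b,\{c,d,e\}_1\}_2$; (3) $\{\{a,b,c\}_3,d,e\}_1=\{a,\{d,c,b\}_2,e\}_2=\{a,b,\{c,d,e\}_1\}_3$; (4) $\{\{a,b,c\}_3,d,e\}_2=\{a,\{d,c,b\}_1,e\}_2=\{a,b,\{c,d,e\}_2\}_3$; (5) $\{\{a,b,c\}_3,d,e\}_3=\{a,\{d,c,b\}_3,e\}_3=\{a,b,\{c,d,e\}_3\}_3$; (6) $\{\{a,b,c\}_1,d,e\}_2=\{\{a,b,c\}_2,d,e\}_2=\{\{a,b,c\}_3,d,e\}_2$; (7) $\{\{a,b,c\}_1,d,e\}_3=\{\{a,b,c\}_2,d,e\}_3=\{\{a,b,c\}_3,d,e\}_3$;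 (8) $\{a,\{b,c,d\}_1,e\}_1=\{a,\{b,c,d\}_2,e\}_1=\{a,\{b,c,d\}_3,e\}_1$; (9) $\{a,\{b,c,d\}_1,e\}_3=\{a,\{b,c,d\}_2,e\}_3=\{a,\{b,c,d\}_3,e\}_3$; (10) $\{a,b,\{c,d,e\}_1\}_1=\{a,b,\{c,d,e\}_2\}_1=\{a,b,\{c,d,e\}_3\}_1$; (11) $\{a,b,\{c,d,e\}_1\}_2=\{a,b,\{c,d,e\}_2\}_2=\{a,b,\{c,d,e\}_3\}_2$. A Leibniz triple system is a $\phi$-module $T$ with a trilinear operation $[\,,\,,\,]:T\times T\times T\to T$ satisfying for all $a,b,c,d,e\in T$: (LTSA) $[a,b,[c,d,e]]-[[a,b,c],d,e]+[[a,b,d],c,e]-[[a,b,e],d,c]+[[a,b,e],c,d]=0$; (LTSB) $[a,[b,c,d],e]-[[a,b,c],d,e]+[[a,c,b],d,e]+[[a,d,b],c,e]-[[a,d,c],b,e]=0$. *)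

theory Defs
  imports Main "HOL.Modules"
begin

definition trilinear ::
    "('r::comm_ring_1 \<Rightarrow> 'a::ab_group_add \<Rightarrow> 'a) \<Rightarrow> ('a \<Rightarrow> 'a \<Rightarrow> 'a \<Rightarrow> 'a) \<Rightarrow> bool" where
  "trilinear scale f \<longleftrightarrow>
     (\<forall>b c. module_hom scale scale (\<lambda>a. f a b c)) \<and>
     (\<forall>a c. module_hom scale scale (\<lambda>b. f a b c)) \<and>
     (\<forall>a b. module_hom scale scale (\<lambda>c. f a b c))"

text \<open>
  The middle expressions in the first five identities reverse the inner
  arguments: they contain (d, c, b), not (b, c, d).
\<close>

locale assoc_triple_trisystem_2nd_kind = module scale
  for scale :: "'r::comm_ring_1 \<Rightarrow> 'a::ab_group_add \<Rightarrow> 'a" +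
  fixes t1 :: "'a \<Rightarrow> 'a \<Rightarrow> 'a \<Rightarrow> 'a" (\<open>\<lbrace>_, _, _\<rbrace>\<^sub>1\<close>)
    and t2 :: "'a \<Rightarrow> 'a \<Rightarrow> 'a \<Rightarrow> 'a" (\<open>\<lbrace>_, _, _\<rbrace>\<^sub>2\<close>)
    and t3 :: "'a \<Rightarrow> 'a \<Rightarrow> 'a \<Rightarrow> 'a" (\<open>\<lbrace>_, _, _\<rbrace>\<^sub>3\<close>)
  assumes trilinear_1: "trilinear scale t1"
    and trilinear_2: "trilinear scale t2"
    and trilinear_3: "trilinear scale t3"
    and ATT1:
      "\<lbrace>\<lbrace>a, b, c\<rbrace>\<^sub>1, d, e\<rbrace>\<^sub>1 = \<lbrace>a, \<lbrace>d, c, b\<rbrace>\<^sub>1, e\<rbrace>\<^sub>1"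
      "\<lbrace>a, \<lbrace>d, c, b\<rbrace>\<^sub>1, e\<rbrace>\<^sub>1 = \<lbrace>a, b, \<lbrace>c, d, e\<rbrace>\<^sub>1\<rbrace>\<^sub>1"
    and ATT2:
      "\<lbrace>\<lbrace>a, b, c\<rbrace>\<^sub>2, d, e\<rbrace>\<^sub>1 = \<lbrace>a, \<lbrace>d, c, b\<rbrace>\<^sub>3, e\<rbrace>\<^sub>2"
      "\<lbrace>a, \<lbrace>d, c, b\<rbrace>\<^sub>3, e\<rbrace>\<^sub>2 = \<lbrace>a, b, \<lbrace>c, d, e\<rbrace>\<^sub>1\<rbrace>\<^sub>2"
    and ATT3:
      "\<lbrace>\<lbrace>a, b, c\<rbrace>\<^sub>3, d, e\<rbrace>\<^sub>1 = \<lbrace>a, \<lbrace>d, c, b\<rbrace>\<^sub>2, e\<rbrace>\<^sub>2"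
      "\<lbrace>a, \<lbrace>d, c, b\<rbrace>\<^sub>2, e\<rbrace>\<^sub>2 = \<lbrace>a, b, \<lbrace>c, d, e\<rbrace>\<^sub>1\<rbrace>\<^sub>3"
    and ATT4:
      "\<lbrace>\<lbrace>a, b, c\<rbrace>\<^sub>3, d, e\<rbrace>\<^sub>2 = \<lbrace>a, \<lbrace>d, c, b\<rbrace>\<^sub>1, e\<rbrace>\<^sub>2"
      "\<lbrace>a, \<lbrace>d, c, b\<rbrace>\<^sub>1, e\<rbrace>\<^sub>2 = \<lbrace>a, b, \<lbrace>c, d, e\<rbrace>\<^sub>2\<rbrace>\<^sub>3"
    and ATT5:
      "\<lbrace>\<lbrace>a, b, c\<rbrace>\<^sub>3, d, e\<rbrace>\<^sub>3 = \<lbrace>a, \<lbrace>d, c, b\<rbrace>\<^sub>3, e\<rbrace>\<^sub>3"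
      "\<lbrace>a, \<lbrace>d, c, b\<rbrace>\<^sub>3, e\<rbrace>\<^sub>3 = \<lbrace>a, b, \<lbrace>c, d, e\<rbrace>\<^sub>3\<rbrace>\<^sub>3"
    and ATT6:
      "\<lbrace>\<lbrace>a, b, c\<rbrace>\<^sub>1, d, e\<rbrace>\<^sub>2 = \<lbrace>\<lbrace>a, b, c\<rbrace>\<^sub>2, d, e\<rbrace>\<^sub>2"
      "\<lbrace>\<lbrace>a, b, c\<rbrace>\<^sub>2, d, e\<rbrace>\<^sub>2 = \<lbrace>\<lbrace>a, b, c\<rbrace>\<^sub>3, d, e\<rbrace>\<^sub>2"
    and ATT7:
      "\<lbrace>\<lbrace>a, b, c\<rbrace>\<^sub>1, d, e\<rbrace>\<^sub>3 = \<lbrace>\<lbrace>a, b, c\<rbrace>\<^sub>2, d, e\<rbrace>\<^sub>3"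
      "\<lbrace>\<lbrace>a, b, c\<rbrace>\<^sub>2, d, e\<rbrace>\<^sub>3 = \<lbrace>\<lbrace>a, b, c\<rbrace>\<^sub>3, d, e\<rbrace>\<^sub>3"
    and ATT8:
      "\<lbrace>a, \<lbrace>b, c, d\<rbrace>\<^sub>1, e\<rbrace>\<^sub>1 = \<lbrace>a, \<lbrace>b, c, d\<rbrace>\<^sub>2, e\<rbrace>\<^sub>1"
      "\<lbrace>a, \<lbrace>b, c, d\<rbrace>\<^sub>2, e\<rbrace>\<^sub>1 = \<lbrace>a, \<lbrace>b, c, d\<rbrace>\<^sub>3, e\<rbrace>\<^sub>1"
    and ATT9:
      "\<lbrace>a, \<lbrace>b, c, d\<rbrace>\<^sub>1, e\<rbrace>\<^sub>3 = \<lbrace>a, \<lbrace>b, c, d\<rbrace>\<^sub>2, e\<rbrace>\<^sub>3"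
      "\<lbrace>a, \<lbrace>b, c, d\<rbrace>\<^sub>2, e\<rbrace>\<^sub>3 = \<lbrace>a, \<lbrace>b, c, d\<rbrace>\<^sub>3, e\<rbrace>\<^sub>3"
    and ATT10:
      "\<lbrace>a, b, \<lbrace>c, d, e\<rbrace>\<^sub>1\<rbrace>\<^sub>1 = \<lbrace>a, b, \<lbrace>c, d, e\<rbrace>\<^sub>2\<rbrace>\<^sub>1"
      "\<lbrace>a, b, \<lbrace>c, d, e\<rbrace>\<^sub>2\<rbrace>\<^sub>1 = \<lbrace>a, b, \<lbrace>c, d, e\<rbrace>\<^sub>3\<rbrace>\<^sub>1"
    and ATT11:
      "\<lbrace>a, b, \<lbrace>c, d, e\<rbrace>\<^sub>1\<rbrace>\<^sub>2 = \<lbrace>a, b, \<lbrace>c, d, e\<rbrace>\<^sub>2\<rbrace>\<^sub>2"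
      "\<lbrace>a, b, \<lbrace>c, d, e\<rbrace>\<^sub>2\<rbrace>\<^sub>2 = \<lbrace>a, b, \<lbrace>c, d, e\<rbrace>\<^sub>3\<rbrace>\<^sub>2"

locale leibniz_triple_system = module scale
  for scale :: "'r::comm_ring_1 \<Rightarrow> 'a::ab_group_add \<Rightarrow> 'a" +
  fixes br :: "'a \<Rightarrow> 'a \<Rightarrow> 'a \<Rightarrow> 'a" (\<open>\<lbrakk>_, _, _\<rbrakk>\<close>)
  assumes trilinear_br: "trilinear scale br"
    and LTSA:
      "\<lbrakk>a, b, \<lbrakk>c, d, e\<rbrakk>\<rbrakk> - \<lbrakk>\<lbrakk>a, b, c\<rbrakk>, d, e\<rbrakk> + \<lbrakk>\<lbrakk>a, b, d\<rbrakk>, c, e\<rbrakk>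
        - \<lbrakk>\<lbrakk>a, b, e\<rbrakk>, d, c\<rbrakk> + \<lbrakk>\<lbrakk>a, b, e\<rbrakk>, c, d\<rbrakk> = 0"
    and LTSB:
      "\<lbrakk>a, \<lbrakk>b, c, d\<rbrakk>, e\<rbrakk> - \<lbrakk>\<lbrakk>a, b, c\<rbrakk>, d, e\<rbrakk> + \<lbrakk>\<lbrakk>a, c, b\<rbrakk>, d, e\<rbrakk>
        + \<lbrakk>\<lbrakk>a, d, b\<rbrakk>, c, e\<rbrakk> - \<lbrakk>\<lbrakk>a, d, c\<rbrakk>, b, e\<rbrakk> = 0"

end

theory Submission
  imports Defs
begin

text \<open>
  By the axioms a nested product depends only on the word of its five arguments (with the arguments
  of an inner product in middle position read backwards) and on which of five classes its shape
  belongs to. Each class contains exactly one of the right-nested shapes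
  \<open>{a,b,{c,d,e}\<^sub>3}\<^sub>1\<close>, \<open>{a,b,{c,d,e}\<^sub>3}\<^sub>2\<close> and \<open>{a,b,{c,d,e}\<^sub>i}\<^sub>3\<close> for \<open>i = 1, 2, 3\<close>, so these are normal
  forms. In each of the two Leibniz identities the normal forms cancel term by term.
\<close>

lemma trilinear_add_diff:
  assumes "trilinear s f"
  shows "f (x + y) b c = f x b c + f y b c" "f (x - y) b c = f x b c - f y b c"
    and "f a (x + y) c = f a x c + f a y c" "f a (x - y) c = f a x c - f a y c"
    and "f a b (x + y) = f a b x + f a b y" "f a b (x - y) = f a b x - f a b y"
proof -
  from assms have "module_hom s s (\<lambda>a. f a b c)" "module_hom s s (\<lambda>b. f a b c)"
    "module_hom s s (\<lambda>c. f a b c)"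
    by (simp_all add: trilinear_def)
  from this[THEN module_hom.add] this[THEN module_hom.diff]
  show "f (x + y) b c = f x b c + f y b c" "f (x - y) b c = f x b c - f y b c"
    "f a (x + y) c = f a x c + f a y c" "f a (x - y) c = f a x c - f a y c"
    "f a b (x + y) = f a b x + f a b y" "f a b (x - y) = f a b x - f a b y"
    by blast+
qed

context assoc_triple_trisystem_2nd_kind
begin

text \<open>With all three products read as abc in an associative algebra, this is the double
  commutator [[a,b],c].\<close>

definition bracket :: "'a \<Rightarrow> 'a \<Rightarrow> 'a \<Rightarrow> 'a" where
  "bracket a b c = \<lbrace>a, b, c\<rbrace>\<^sub>1 - \<lbrace>b, a, c\<rbrace>\<^sub>2 - \<lbrace>c, a, b\<rbrace>\<^sub>2 + \<lbrace>c, b, a\<rbrace>\<^sub>3"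

lemma trilinear_bracket: "trilinear scale bracket"
proof -
  \<comment> \<open>Supplies closure of homomorphisms under sums and differences, applied in each
    argument separately.\<close>
  interpret module_pair scale scale ..
  show ?thesis
    using trilinear_1 trilinear_2 trilinear_3
    unfolding trilinear_def bracket_def
    by (intro conjI allI module_hom_add module_hom_sub) blast+
qed

text \<open>
  Only ATT8 is reversed: used left to right, it would compete with ATT1 for the same left-hand side
  and the rewriting would not be confluent.
\<close>

lemmas nested_normal_form =
  ATT1 ATT2 ATT3 ATT4 ATT5 ATT6 ATT7 ATT8[symmetric] ATT9 ATT10 ATT11

lemmas bracket_expand =
  bracket_def trilinear_add_diff[OF trilinear_1] trilinear_add_diff[OF trilinear_2]
  trilinear_add_diff[OF trilinear_3]

text \<open>Each double bracket multiplies out to 16 signed nested products; once these are in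
  normal form, only cancellation in the abelian group remains.\<close>

lemma bracket_LTSA:
  "bracket a b (bracket c d e) - bracket (bracket a b c) d e + bracket (bracket a b d) c e
    - bracket (bracket a b e) d c + bracket (bracket a b e) c d = 0"
  by (simp add: bracket_expand nested_normal_form)

lemma bracket_LTSB:
  "bracket a (bracket b c d) e - bracket (bracket a b c) d e + bracket (bracket a c b) d e
    + bracket (bracket a d b) c e - bracket (bracket a d c) b e = 0"
  by (simp add: bracket_expand nested_normal_form)

end

theorem theorem6:
  fixes scale :: "'r::comm_ring_1 \<Rightarrow> 'a::ab_group_add \<Rightarrow> 'a"
    and t1 t2 t3 :: "'a \<Rightarrow> 'a \<Rightarrow> 'a \<Rightarrow> 'a"
  assumes half: "\<exists>h::'r. 2 * h = 1"
    and A: "assoc_triple_trisystem_2nd_kind scale t1 t2 t3"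
  shows "leibniz_triple_system scale
    (\<lambda>a b c. t1 a b c - t2 b a c - t2 c a b + t3 c b a)"
proof -
  interpret assoc_triple_trisystem_2nd_kind scale t1 t2 t3 by (fact A)
  have "leibniz_triple_system scale bracket"
    by unfold_locales (fact trilinear_bracket bracket_LTSA bracket_LTSB)+
  then show ?thesis
    \<comment> \<open>\<open>bracket\<close> occurs unapplied here, so its definition must be an
      equation between functions.\<close>
    by (simp add: bracket_def[abs_def])
qed

end
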